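(* The tangent space $\mathfrak g=G^0$ at $1$ to the left-linear group $(G^1,\bullet)$, equipped with the bilinear product $\triangleleft$ given by the bidegree $(1,1)$ part of the group law, is a right pre-Lie algebra: for all $a,b,c\in G^0$, $$(a\triangleleft b)\triangleleft c-a\triangleleft(b\triangleleft c)=(a\triangleleft c)\triangleleft b-a\triangleleft(c\triangleleft b).$$
   Context: $\mathbb K$ is a field of characteristic zero and $A$ is a commutative unital $\mathbb K$-algebra. $R=A\langle\langle x_1,x_2,x_3,\dots\rangle\rangle$ is the ring of formal power series in countably many non-commuting variables with coefficients in $A$ (commuting with the variables). $\mathbb N^*$ is the set of non-empty finite words over $\mathbb N=\{1,2,\dots\}$, $\mathbf 1$ is the empty word; elements of $R$ are arbitrary formal sums $f=\sum_{w\in\mathbb N^*\cup\{\mathbf 1\}}f_wx_w$, $f_w\in A$, with $x_w=x_{i_1}\cdots x_{i_m}$ for $w=i_1\cdots i_m$, $x_{\mathbf 1}=1_A$. $G^1=\{f\in R:f_{\mathbf 1}=1_A\}$ and $G^0=\{f\in R: f_{\mathbf 1}=0\}$. The group law on $G^1$ is the shifted composition $(f\bullet g)(x)=g(x)f(xg(x))$, where $f(xg(x))$ is obtained from $f$ by substituting $x_ig(x)$ for each $x_i$. Using as coordinates of $f=1_A+f'\in G^1$ the coefficients $(f_v)_{v\in\mathbb N^*}$ of $f'\in G^0$, the group is left-linear: $f\bullet g-g$ is linear in the coordinates of $f$. For $f',g'\in G^0$, $f'\triangleleft g'$ is the component of $(1_A+f')\bullet(1_A+g')$ that is of degree $1$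 in the coordinates of $f'$ and of degree $1$ in the coordinates of $g'$. On monomials it is given by $$x_{i_1}\cdots x_{i_n}\triangleleft x_{j_1}\cdots x_{j_m}=\sum_{k=0}^n x_{i_1}\cdots x_{i_k}\,x_{j_1}\cdots x_{j_m}\,x_{i_{k+1}}\cdots x_{i_n},$$ extended to series $A$-bilinearly (each coefficient is a finite sum). *)

theory Defs
  imports "HOL-Computational_Algebra.Polynomial" "HOL-Library.Groups_Big_Fun"
begin

section \<open>Formal power series in countably many non-commuting variables\<close>

text \<open>
  A series is its family of coefficients, indexed by all words (the empty word included).
  The letters are the elements of \<^typ>\<open>nat\<close>, so that the variables are
  \<open>ncps_X 0, ncps_X 1, \<dots>\<close> rather than \<open>x_1, x_2, \<dots>\<close>.
\<close>

typedef 'a ncps = "UNIV :: (nat list \<Rightarrow> 'a) set"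
  morphisms ncps_nth Abs_ncps
  by simp

lemma ncps_nth_Abs [simp]: "ncps_nth (Abs_ncps f) = f"
  by (simp add: Abs_ncps_inverse)

lemma ncps_eqI: "(\<And>w. ncps_nth f w = ncps_nth g w) \<Longrightarrow> f = g"
  by (metis ext ncps_nth_inject)

instantiation ncps :: (comm_ring_1) ring_1
begin

definition zero_ncps :: "'a ncps" where
  "zero_ncps = Abs_ncps (\<lambda>w. 0)"

definition one_ncps :: "'a ncps" where
  "one_ncps = Abs_ncps (\<lambda>w. if w = [] then 1 else 0)"

definition plus_ncps :: "'a ncps \<Rightarrow> 'a ncps \<Rightarrow> 'a ncps" where
  "plus_ncps f g = Abs_ncps (\<lambda>w. ncps_nth f w + ncps_nth g w)"

definition uminus_ncps :: "'a ncps \<Rightarrow> 'a ncps" where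
  "uminus_ncps f = Abs_ncps (\<lambda>w. - ncps_nth f w)"

definition minus_ncps :: "'a ncps \<Rightarrow> 'a ncps \<Rightarrow> 'a ncps" where
  "minus_ncps f g = Abs_ncps (\<lambda>w. ncps_nth f w - ncps_nth g w)"

definition times_ncps :: "'a ncps \<Rightarrow> 'a ncps \<Rightarrow> 'a ncps" where
  "times_ncps f g =
    Abs_ncps (\<lambda>w. \<Sum>k\<le>length w. ncps_nth f (take k w) * ncps_nth g (drop k w))"

instance
proof
  fix f g h :: "'a ncps"
  show "f * g * h = f * (g * h)"
  proof (rule ncps_eqI)
    fix w :: "nat list"
    let ?n = "length w"
    have "ncps_nth (f * g * h) w = (\<Sum>(j, i)\<in>Sigma {..?n} (\<lambda>j. {..j}).
        ncps_nth f (take i w) * ncps_nth g (drop i (take j w)) * ncps_nth h (drop j w))"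
      unfolding times_ncps_def ncps_nth_Abs sum.Sigma [OF finite_atMost ballI, OF finite_atMost, symmetric]
      by (intro sum.cong refl) (simp add: sum_distrib_right min_absorb1 min_absorb2)
    also have "\<dots> = (\<Sum>(i, l)\<in>Sigma {..?n} (\<lambda>i. {..?n - i}).
        ncps_nth f (take i w) * (ncps_nth g (take l (drop i w)) * ncps_nth h (drop l (drop i w))))"
      by (rule sum.reindex_bij_witness
          [where i = "\<lambda>(i, l). (i + l, i)" and j = "\<lambda>(j, i). (i, j - i)"])
        (auto simp: mult.assoc drop_take add.commute)
    also have "\<dots> = ncps_nth (f * (g * h)) w"
      by (simp add: times_ncps_def sum_distrib_left sum.Sigma [symmetric])
    finally show "ncps_nth (f * g * h) w = ncps_nth (f * (g * h)) w" .
  qed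
  show "1 * f = f"
  proof (rule ncps_eqI)
    fix w
    have "ncps_nth (1 * f) w = (\<Sum>k\<le>length w. if k = 0 then ncps_nth f w else 0)"
      unfolding times_ncps_def one_ncps_def ncps_nth_Abs by (intro sum.cong) auto
    then show "ncps_nth (1 * f) w = ncps_nth f w" by simp
  qed
  show "f * 1 = f"
  proof (rule ncps_eqI)
    fix w
    have "ncps_nth (f * 1) w = (\<Sum>k\<le>length w. if k = length w then ncps_nth f w else 0)"
      unfolding times_ncps_def one_ncps_def ncps_nth_Abs by (intro sum.cong) auto
    then show "ncps_nth (f * 1) w = ncps_nth f w" by simp
  qed
  show "(0::'a ncps) \<noteq> 1"
  proof
    assume "(0::'a ncps) = 1"
    then have "ncps_nth (0::'a ncps) [] = ncps_nth 1 []" by simp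
    then show False by (simp add: zero_ncps_def one_ncps_def)
  qed
qed (auto simp: zero_ncps_def plus_ncps_def uminus_ncps_def minus_ncps_def times_ncps_def
    algebra_simps sum.distrib intro!: ncps_eqI)

end

definition ncps_map :: "('a \<Rightarrow> 'b) \<Rightarrow> 'a ncps \<Rightarrow> 'b ncps" where
  "ncps_map h f = Abs_ncps (\<lambda>w. h (ncps_nth f w))"

definition ncps_smult :: "'a::comm_ring_1 \<Rightarrow> 'a ncps \<Rightarrow> 'a ncps" where
  "ncps_smult c = ncps_map ((*) c)"

definition ncps_X :: "nat \<Rightarrow> 'a::comm_ring_1 ncps" where
  "ncps_X i = Abs_ncps (\<lambda>w. if w = [i] then 1 else 0)"

text \<open>
  Substitution of \<open>y i\<close> for the \<open>i\<close>-th variable, \<open>\<Sum>\<^sub>w f\<^sub>w y\<^sub>w\<close>, computed coefficientwise.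
  The sum over all words is the finite sum over its support, which is meaningful only if that
  support is finite. It is so for \<open>y i = ncps_X i * g\<close>: the coefficient of \<open>y\<^sub>w\<close> at \<open>u\<close> vanishes unless
  \<open>w\<close> is a subsequence of \<open>u\<close>.
\<close>

definition ncps_subst :: "'a::comm_ring_1 ncps \<Rightarrow> (nat \<Rightarrow> 'a ncps) \<Rightarrow> 'a ncps" where
  "ncps_subst f y =
    Abs_ncps (\<lambda>u. Sum_any (\<lambda>w. ncps_nth f w * ncps_nth (prod_list (map y w)) u))"


section \<open>The shifted composition and its bidegree components\<close>

definition G0 :: "'a::comm_ring_1 ncps set" where
  "G0 = {f. ncps_nth f [] = 0}"

text \<open>The group law on the series with constant term \<open>1\<close>: \<open>(f \<bullet> g)(x) = g(x) f(x g(x))\<close>.\<close>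

definition shifted_comp :: "'a::comm_ring_1 ncps \<Rightarrow> 'a ncps \<Rightarrow> 'a ncps" where
  "shifted_comp f g = g * ncps_subst f (\<lambda>i. ncps_X i * g)"

text \<open>
  The component of \<open>(1 + f) \<bullet> (1 + g)\<close> of degree \<open>i\<close> in the coordinates of \<open>f\<close> and \<open>j\<close> in those
  of \<open>g\<close>. Over \<open>A[s][t]\<close>, multiply all coordinates of \<open>f\<close> by \<open>s\<close> and all those of \<open>g\<close> by \<open>t\<close>;
  the component is then the coefficient of \<open>s\<^sup>i t\<^sup>j\<close>. Here \<open>t\<close> is the variable of the outer
  polynomial ring and \<open>s\<close> that of the inner one.
\<close>

definition bidegree_component :: "nat \<Rightarrow> nat \<Rightarrow> 'a::comm_ring_1 ncps \<Rightarrow> 'a ncps \<Rightarrow> 'a ncps" where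
  "bidegree_component i j f g =
    (let s = [:[:0, 1:]:]; t = [:0, 1:]; \<iota> = ncps_map (\<lambda>a. [:[:a:]:]) in
     ncps_map (\<lambda>p. poly.coeff (poly.coeff p j) i)
       (shifted_comp (1 + ncps_smult s (\<iota> f)) (1 + ncps_smult t (\<iota> g))))"

definition pre_lie_prod :: "'a::comm_ring_1 ncps \<Rightarrow> 'a ncps \<Rightarrow> 'a ncps" where
  "pre_lie_prod f g = bidegree_component 1 1 f g"


section \<open>Algebraic structures\<close>

text \<open>
  Commutative unital algebras over a field. Commutativity and the unit come from the class of
  \<^typ>\<open>'a\<close>.
\<close>

locale comm_unital_algebra = vector_space scale
  for scale :: "'k::field \<Rightarrow> 'a::comm_ring_1 \<Rightarrow> 'a" +
  assumes scale_mult_left: "scale c (x * y) = scale c x * y"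

locale right_pre_lie_algebra = module scale
  for scale :: "'r::comm_ring_1 \<Rightarrow> 'v::ab_group_add \<Rightarrow> 'v" +
  fixes V :: "'v set"
    and tri :: "'v \<Rightarrow> 'v \<Rightarrow> 'v"  (infixl \<open>\<triangleleft>\<close> 70)
  assumes subspace_carrier: "subspace V"
    and prod_closed: "\<lbrakk>a \<in> V; b \<in> V\<rbrakk> \<Longrightarrow> a \<triangleleft> b \<in> V"
    and prod_add_left: "\<lbrakk>a \<in> V; b \<in> V; c \<in> V\<rbrakk> \<Longrightarrow> (a + b) \<triangleleft> c = a \<triangleleft> c + b \<triangleleft> c"
    and prod_add_right: "\<lbrakk>a \<in> V; b \<in> V; c \<in> V\<rbrakk> \<Longrightarrow> a \<triangleleft> (b + c) = a \<triangleleft> b + a \<triangleleft> c"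
    and prod_scale_left: "\<lbrakk>a \<in> V; b \<in> V\<rbrakk> \<Longrightarrow> scale r a \<triangleleft> b = scale r (a \<triangleleft> b)"
    and prod_scale_right: "\<lbrakk>a \<in> V; b \<in> V\<rbrakk> \<Longrightarrow> a \<triangleleft> scale r b = scale r (a \<triangleleft> b)"
    and right_pre_lie: "\<lbrakk>a \<in> V; b \<in> V; c \<in> V\<rbrakk> \<Longrightarrow>
      (a \<triangleleft> b) \<triangleleft> c - a \<triangleleft> (b \<triangleleft> c) = (a \<triangleleft> c) \<triangleleft> b - a \<triangleleft> (c \<triangleleft> b)"

end

theory Submission imports Defs begin

text \<open>
  Since \<open>f \<bullet> g\<close> is linear in \<open>f\<close>, the bidegree \<open>(1,1)\<close> component is
  \<open>\<Sum>\<^sub>w f\<^sub>w E\<^sub>w\<close>, where \<open>E\<^sub>w\<close> is the part of \<open>(1 + g) \<cdot> x\<^sub>w(x(1 + g))\<close> that is linear in \<open>g\<close>.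
  The product rule gives \<open>E\<close> of the word \<open>i # w\<close> as \<open>g x\<^sub>i x\<^sub>w + x\<^sub>i E\<^sub>w\<close>, so \<open>E\<^sub>w\<close> is the sum of the
  insertions of \<open>g\<close> into \<open>x\<^sub>w\<close>. Hence the coefficient of \<open>f \<triangleleft> g\<close> at \<open>u\<close> is the sum, over all
  factors \<open>v\<close> of \<open>u\<close>, of \<open>g\<^sub>v\<close> times the coefficient of \<open>f\<close> at \<open>u\<close> with \<open>v\<close> removed.
  In \<open>(a \<triangleleft> b) \<triangleleft> c\<close>, the terms in which the factor read by \<open>c\<close> lies inside (or at the border of)
  the one read by \<open>b\<close> add up to \<open>a \<triangleleft> (b \<triangleleft> c)\<close>. What is left is the sum over pairs of
  factors separated by at least one letter, which is symmetric in \<open>b\<close> and \<open>c\<close>.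
\<close>

section \<open>Insertion of words\<close>

text \<open>Cut positions index the sum, so equal factors at different places count separately, and
  \<open>i = j\<close> gives an empty factor at each of the \<open>length u + 1\<close>
  places.\<close>

definition insertion :: "(nat list \<Rightarrow> 'a::comm_ring_1) \<Rightarrow> (nat list \<Rightarrow> 'a) \<Rightarrow> nat list \<Rightarrow> 'a" where
  "insertion f g u =
    (\<Sum>i\<le>length u. \<Sum>j\<in>{i..length u}. f (take i u @ drop j u) * g (drop i (take j u)))"

text \<open>\<open>g\<close> reads the left factor and \<open>h\<close> the right one;
  \<open>q < i\<close> keeps a letter between them.\<close>

definition separated_insertion ::
  "(nat list \<Rightarrow> 'a::comm_ring_1) \<Rightarrow> (nat list \<Rightarrow> 'a) \<Rightarrow> (nat list \<Rightarrow> 'a) \<Rightarrow> nat list \<Rightarrow> 'a" where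
  "separated_insertion f g h u =
    (\<Sum>(p, q, i, j) \<in> {(p, q, i, j). p \<le> q \<and> q < i \<and> i \<le> j \<and> j \<le> length u}.
      f (take p u @ drop q (take i u) @ drop j u) * g (drop p (take q u)) * h (drop i (take j u)))"

lemma finite_bounded_quadruples:
  assumes "\<And>p q i j. (p, q, i, j) \<in> S \<Longrightarrow> p \<le> n \<and> q \<le> n \<and> i \<le> n \<and> j \<le> (n::nat)"
  shows "finite S"
  by (rule finite_subset[of _ "{..n} \<times> {..n} \<times> {..n} \<times> {..n}"]) (use assms in auto)

text \<open>A cut \<open>p\<close> at or behind the gap left by the factor sits at
  \<open>p + (j - i)\<close> in \<open>u\<close>.\<close>

lemma take_remove_factor:
  assumes "i \<le> j" "j \<le> length u" "i \<le> p"
  shows "take p (take i u @ drop j u) = take i u @ drop j (take (p + (j - i)) u)"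
  using assms by (simp add: drop_take min_absorb2)

lemma drop_remove_factor:
  assumes "i \<le> j" "j \<le> length u" "i \<le> p"
  shows "drop p (take i u @ drop j u) = drop (p + (j - i)) u"
  using assms by (simp add: min_absorb2)

lemma sum_Sigma_nested:
  assumes "finite A" "\<And>x. x \<in> A \<Longrightarrow> finite (B x)"
  shows "sum h (Sigma A B) = (\<Sum>x\<in>A. \<Sum>y\<in>B x. h (x, y))"
  using assms by (simp add: sum.Sigma)

text \<open>The gap \<open>i\<close> left by the factor of \<open>c\<close> lies between the cuts
  \<open>p\<close> and \<open>q\<close> of the factor of \<open>b\<close>, ends included
  (\<open>L0\<close>), behind both (\<open>L1\<close>) or before both (\<open>L2\<close>).\<close>

lemma insertion_insertion_left:
  "insertion (insertion a b) c u =
    insertion a (insertion b c) u + separated_insertion a b c u + separated_insertion a c b u"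
proof -
  define n where "n = length u"
  \<comment> \<open>\<open>i, j\<close> cut the factor of \<open>c\<close> out of \<open>u\<close>;
    \<open>p, q\<close> are positions in the shortened word \<open>v\<close>, which has length
    \<open>i + (n - j)\<close>.\<close>
  define t where "t = (\<lambda>(i, j, p, q). let v = take i u @ drop j u in
    a (take p v @ drop q v) * b (drop p (take q v)) * c (drop i (take j u)))"
  define L where "L = {(i, j, p, q). i \<le> j \<and> j \<le> n \<and> p \<le> q \<and> q \<le> i + (n - j)}"
  define L0 where "L0 = {(i, j, p, q). i \<le> j \<and> j \<le> n \<and> p \<le> i \<and> i \<le> q \<and> q \<le> i + (n - j)}"
  define L1 where "L1 = {(i, j, p, q). i \<le> j \<and> j \<le> n \<and> p \<le> q \<and> q < i}"
  define L2 where "L2 = {(i, j, p, q). i \<le> j \<and> j \<le> n \<and> i < p \<and> p \<le> q \<and> q \<le> i + (n - j)}"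
  have fin: "finite L0" "finite L1" "finite L2"
    by (rule finite_bounded_quadruples[where n = n]; force simp: L0_def L1_def L2_def)+
  have L: "L = L0 \<union> (L1 \<union> L2)" "L0 \<inter> (L1 \<union> L2) = {}" "L1 \<inter> L2 = {}"
    by (auto simp: L_def L0_def L1_def L2_def)
  have "insertion (insertion a b) c u =
      (\<Sum>i\<le>n. \<Sum>j\<in>{i..n}. \<Sum>p\<le>i + (n - j). \<Sum>q\<in>{p..i + (n - j)}. t (i, j, p, q))"
    unfolding insertion_def n_def
    by (intro sum.cong refl) (auto simp: t_def Let_def sum_distrib_right min_absorb2)
  also have "\<dots> = sum t (SIGMA i:{..n}. SIGMA j:{i..n}. SIGMA p:{..i + (n - j)}. {p..i + (n - j)})"
    by (simp add: sum_Sigma_nested)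
  also have "(SIGMA i:{..n}. SIGMA j:{i..n}. SIGMA p:{..i + (n - j)}. {p..i + (n - j)}) = L"
    by (auto simp: L_def)
  also have "sum t L = sum t L0 + (sum t L1 + sum t L2)"
    using fin L by (simp add: sum.union_disjoint)
  also have "sum t L1 = separated_insertion a b c u"
    unfolding separated_insertion_def
    by (rule sum.reindex_bij_witness
        [where i = "\<lambda>(p, q, i, j). (i, j, p, q)" and j = "\<lambda>(i, j, p, q). (p, q, i, j)"])
      (auto simp: L1_def t_def n_def Let_def min_absorb1)
  \<comment> \<open>Here \<open>c\<close> reads the left factor, and the cuts of \<open>b\<close>
    move by \<open>j - i\<close> on returning to \<open>u\<close>.\<close>
  also have "sum t L2 = separated_insertion a c b u"
    unfolding separated_insertion_def
  proof (rule sum.reindex_bij_witness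
      [where i = "\<lambda>(i, j, p, q). (i, j, p + i - j, q + i - j)"
        and j = "\<lambda>(i, j, p, q). (i, j, p + (j - i), q + (j - i))"], goal_cases)
    case (5 x)
    then obtain i j p q where x: "x = (i, j, p, q)"
      and le: "i \<le> j" "j \<le> length u" "i \<le> p" "p \<le> q"
      by (auto simp: L2_def n_def)
    have "drop p (take q (take i u @ drop j u)) = drop (p + (j - i)) (take (q + (j - i)) u)"
      by (simp add: drop_take[of p] drop_take[of "p + (j - i)"] drop_remove_factor[OF le(1,2,3)]
          del: take_append drop_append)
    moreover have "drop q (take i u @ drop j u) = drop (q + (j - i)) u"
      using le by (intro drop_remove_factor) auto
    ultimately show ?case
      by (simp only: x t_def Let_def prod.case take_remove_factor[OF le(1,2,3)] append_assoc
          mult.assoc mult.commute[of "b _"])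
  qed (auto simp: L2_def n_def)
  also have "sum t L0 = insertion a (insertion b c) u"
  proof -
    \<comment> \<open>\<open>p, q\<close> now cut the joint factor of \<open>b\<close> and
      \<open>c\<close> out of \<open>u\<close>, and \<open>k, l\<close> are positions inside
      it.\<close>
    define s where "s = (\<lambda>(p, q, k, l). let v = drop p (take q u) in
      a (take p u @ drop q u) * (b (take k v @ drop l v) * c (drop k (take l v))))"
    define R where "R = {(p, q, k, l). p \<le> q \<and> q \<le> n \<and> k \<le> l \<and> l \<le> q - p}"
    have "insertion a (insertion b c) u =
        (\<Sum>p\<le>n. \<Sum>q\<in>{p..n}. \<Sum>k\<le>q - p. \<Sum>l\<in>{k..q - p}. s (p, q, k, l))"
      unfolding insertion_def n_def
      by (intro sum.cong refl) (auto simp: s_def Let_def sum_distrib_left min_absorb2)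
    also have "\<dots> = sum s (SIGMA p:{..n}. SIGMA q:{p..n}. SIGMA k:{..q - p}. {k..q - p})"
      by (simp add: sum_Sigma_nested)
    also have "(SIGMA p:{..n}. SIGMA q:{p..n}. SIGMA k:{..q - p}. {k..q - p}) = R"
      by (auto simp: R_def)
    \<comment> \<open>The joint factor starts at \<open>p\<close>, which shifts \<open>k, l\<close>
      by \<open>p\<close>; without the \<open>l - k\<close> letters read by \<open>c\<close> its end
      moves from \<open>q\<close> to \<open>q - (l - k)\<close>.\<close>
    also have "sum s R = sum t L0"
    proof (rule sum.reindex_bij_witness
        [where i = "\<lambda>(i, j, p, q). (p, q + (j - i), i - p, j - p)"
          and j = "\<lambda>(p, q, k, l). (p + k, p + l, p, q - (l - k))"], goal_cases)
      case (5 x)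
      then obtain p q k l where x: "x = (p, q, k, l)"
        and le: "p \<le> q" "q \<le> length u" "k \<le> l" "l \<le> q - p"
        by (auto simp: R_def n_def)
      let ?v = "take (p + k) u @ drop (p + l) u" and ?w = "drop p (take q u)"
      have q: "q - (l - k) + (p + l - (p + k)) = q" and pk: "p + k \<le> q - (l - k)"
        using le by auto
      have "take p ?v = take p u"
        using le by (simp add: min_absorb1)
      moreover have "drop (q - (l - k)) ?v = drop q u"
        using le q pk by (subst drop_remove_factor) auto
      moreover have "drop p (take (q - (l - k)) ?v) = take k ?w @ drop l ?w"
      proof -
        have "take (q - (l - k)) ?v = take (p + k) u @ drop (p + l) (take q u)"
          using le q pk by (subst take_remove_factor) auto
        then show ?thesis
          using le by (simp add: take_drop min_absorb1 add.commute)
      qed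
      moreover have "drop (p + k) (take (p + l) u) = drop k (take l ?w)"
        using le by (simp add: take_drop min_absorb1 add.commute)
      ultimately show ?case
        by (simp only: x s_def t_def Let_def prod.case mult.assoc)
    qed (auto simp: R_def L0_def n_def)
    finally show ?thesis ..
  qed
  finally show ?thesis by (simp add: add.assoc)
qed

text \<open>Both sides reduce to the sum of the two separated insertions, which is symmetric in
  \<open>b\<close> and \<open>c\<close>.\<close>

lemma insertion_right_pre_lie:
  "insertion (insertion a b) c u - insertion a (insertion b c) u =
    insertion (insertion a c) b u - insertion a (insertion c b) u"
  by (simp add: insertion_insertion_left)


section \<open>Coefficients of the bidegree (1,1) component\<close>

lemma ncps_nth_simps [simp]:
  "ncps_nth 0 w = 0"
  "ncps_nth 1 w = (if w = [] then 1 else 0)"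
  "ncps_nth (f + g) w = ncps_nth f w + ncps_nth g w"
  "ncps_nth (f - g) w = ncps_nth f w - ncps_nth g w"
  "ncps_nth (ncps_map h f) w = h (ncps_nth f w)"
  "ncps_nth (ncps_smult c f) w = c * ncps_nth f w"
  by (simp_all add: zero_ncps_def one_ncps_def plus_ncps_def minus_ncps_def ncps_map_def
      ncps_smult_def)

lemma ncps_nth_mult:
  "ncps_nth (f * g) w = (\<Sum>k\<le>length w. ncps_nth f (take k w) * ncps_nth g (drop k w))"
  by (simp add: times_ncps_def)

lemma ncps_nth_X_mult_Nil [simp]: "ncps_nth (ncps_X i * f) [] = 0"
  by (simp add: ncps_nth_mult ncps_X_def)

lemma ncps_nth_X_mult_Cons [simp]:
  "ncps_nth (ncps_X i * f) (y # w) = (if y = i then ncps_nth f w else 0)"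
proof -
  have "ncps_nth (ncps_X i * f) (y # w) =
      (\<Sum>k\<le>Suc (length w). if k = 1 then if y = i then ncps_nth f w else 0 else 0)"
    unfolding ncps_nth_mult
    by (intro sum.cong) (auto simp: ncps_X_def take_Cons' drop_Cons' split: if_splits)
  then show ?thesis by (simp del: sum.atMost_Suc)
qed

definition ncps_monom :: "nat list \<Rightarrow> 'a::comm_ring_1 ncps" where
  "ncps_monom w = prod_list (map ncps_X w)"

lemma ncps_nth_monom: "ncps_nth (ncps_monom w) u = (if u = w then 1 else 0)"
proof (induction w arbitrary: u)
  case (Cons i w)
  then show ?case by (cases u) (auto simp: ncps_monom_def)
qed (simp add: ncps_monom_def)

text \<open>Each factor \<open>ncps_X i * g\<close> uses up a letter \<open>i\<close> of
  \<open>u\<close>. The resulting bound leaves only finitely many words \<open>w\<close>.\<close>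

lemma nth_shifted_word_nonzero:
  assumes "ncps_nth (prod_list (map (\<lambda>i. ncps_X i * g) w)) u \<noteq> 0"
  shows "set w \<subseteq> set u \<and> length w \<le> length u"
  using assms
proof (induction w arbitrary: u)
  case (Cons i w)
  let ?P = "prod_list (map (\<lambda>i. ncps_X i * g) w)"
  from Cons.prems obtain v where u: "u = i # v" and "ncps_nth (g * ?P) v \<noteq> 0"
    by (cases u) (auto simp: mult.assoc split: if_splits)
  then obtain k where "ncps_nth ?P (drop k v) \<noteq> 0"
    by (cases "\<exists>k. ncps_nth ?P (drop k v) \<noteq> 0") (auto simp: ncps_nth_mult)
  from Cons.IH[OF this] u show ?case
    by (auto dest: in_set_dropD)
qed simp

text \<open>One finite \<open>W\<close> serves every suffix of \<open>u\<close>, so the substitution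
  sum can be exchanged with the convolution.\<close>

lemma nth_shifted_comp:
  assumes "finite W" and W: "\<And>w. set w \<subseteq> set u \<Longrightarrow> length w \<le> length u \<Longrightarrow> w \<in> W"
  shows "ncps_nth (shifted_comp f g) u =
    (\<Sum>w\<in>W. ncps_nth f w * ncps_nth (g * prod_list (map (\<lambda>i. ncps_X i * g) w)) u)"
proof -
  let ?P = "\<lambda>w. prod_list (map (\<lambda>i. ncps_X i * g) w)"
  have "ncps_nth (ncps_subst f (\<lambda>i. ncps_X i * g)) (drop k u) =
      (\<Sum>w\<in>W. ncps_nth f w * ncps_nth (?P w) (drop k u))" for k
  proof -
    have "{w. ncps_nth f w * ncps_nth (?P w) (drop k u) \<noteq> 0} \<subseteq> W"
    proof clarify
      fix w assume "ncps_nth f w * ncps_nth (?P w) (drop k u) \<noteq> 0"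
      then have "ncps_nth (?P w) (drop k u) \<noteq> 0" by auto
      from nth_shifted_word_nonzero[OF this] show "w \<in> W"
        by (intro W) (auto dest: in_set_dropD)
    qed
    with \<open>finite W\<close> show ?thesis
      by (simp add: ncps_subst_def Sum_any.expand_superset)
  qed
  then have "ncps_nth (shifted_comp f g) u =
      (\<Sum>k\<le>length u. \<Sum>w\<in>W.
        ncps_nth f w * (ncps_nth g (take k u) * ncps_nth (?P w) (drop k u)))"
    by (simp add: shifted_comp_def ncps_nth_mult sum_distrib_left mult.left_commute)
  also have "\<dots> = (\<Sum>w\<in>W. ncps_nth f w * ncps_nth (g * ?P w) u)"
    by (subst sum.swap) (simp add: ncps_nth_mult sum_distrib_left)
  finally show ?thesis .
qed

text \<open>
  Coefficients of \<open>s\<^sup>0 t\<^sup>0\<close> and \<open>s\<^sup>0 t\<^sup>1\<close>: a ring homomorphism and a derivation along it.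
\<close>

abbreviation degree0_part :: "'a::comm_ring_1 poly poly ncps \<Rightarrow> 'a ncps" where
  "degree0_part \<equiv> ncps_map (\<lambda>p. poly.coeff (poly.coeff p 0) 0)"

abbreviation degree1_part :: "'a::comm_ring_1 poly poly ncps \<Rightarrow> 'a ncps" where
  "degree1_part \<equiv> ncps_map (\<lambda>p. poly.coeff (poly.coeff p 1) 0)"

lemma degree0_part_mult: "degree0_part (f * g) = degree0_part f * degree0_part g"
  by (rule ncps_eqI) (simp add: ncps_nth_mult coeff_sum coeff_mult)

lemma degree1_part_mult:
  "degree1_part (f * g) = degree1_part f * degree0_part g + degree0_part f * degree1_part g"
  by (rule ncps_eqI)
    (simp add: ncps_nth_mult coeff_sum coeff_mult sum.distrib add.commute)

lemma degree_parts_X [simp]: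
  "degree0_part (ncps_X i) = ncps_X i" "degree1_part (ncps_X i) = 0"
  by (rule ncps_eqI; simp add: ncps_X_def)+

lemma degree_parts_1 [simp]: "degree0_part 1 = 1" "degree1_part 1 = 0"
  by (rule ncps_eqI; simp)+

lemma insertion_into_monom:
  fixes g :: "'a::comm_ring_1 ncps"
  assumes G0: "degree0_part G = 1" and G1: "degree1_part G = g"
  shows "ncps_nth (degree1_part (G * prod_list (map (\<lambda>i. ncps_X i * G) w))) u =
    insertion (ncps_nth (ncps_monom w)) (ncps_nth g) u"
proof -
  let ?P = "\<lambda>w. prod_list (map (\<lambda>i. ncps_X i * G) w)"
  define E where "E w = degree1_part (G * ?P w)" for w
  have P0: "degree0_part (?P w) = ncps_monom w" for w
    by (induction w) (simp_all add: degree0_part_mult G0 ncps_monom_def)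
  \<comment> \<open>Either the leading \<open>G\<close> yields \<open>g\<close>, or it yields
    \<open>1\<close>, the letter \<open>i\<close> stays in front and \<open>G * ?P w\<close>
    follows.\<close>
  have E_Cons: "E (i # w) = g * ncps_monom (i # w) + ncps_X i * E w" for i w
  proof -
    have "E (i # w) = g * degree0_part (?P (i # w)) + degree1_part (?P (i # w))"
      by (simp only: E_def degree1_part_mult G0 G1 mult_1_left)
    also have "degree1_part (?P (i # w)) = ncps_X i * E w"
      by (simp add: E_def degree1_part_mult[of "ncps_X i"] mult.assoc del: One_nat_def)
    finally show ?thesis by (simp only: P0)
  qed
  have "ncps_nth (E w) u = insertion (ncps_nth (ncps_monom w)) (ncps_nth g) u"
  proof (induction w arbitrary: u)
    case Nil
    \<comment> \<open>Only removing all of \<open>u\<close> leaves the empty word: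
      \<open>i = 0\<close> and \<open>j = length u\<close>.\<close>
    have "insertion (ncps_nth (ncps_monom [])) (ncps_nth g) u =
        (\<Sum>i\<le>length u. if i = 0 then ncps_nth g u else 0)"
      unfolding insertion_def
    proof (intro sum.cong refl)
      fix i
      have "(\<Sum>j\<in>{i..length u}. ncps_nth (ncps_monom []) (take i u @ drop j u) *
            ncps_nth g (drop i (take j u))) =
          (\<Sum>j\<in>{i..length u}. if j = length u then if i = 0 then ncps_nth g u else 0 else 0)"
        by (intro sum.cong) (auto simp: ncps_nth_monom)
      then show "(\<Sum>j\<in>{i..length u}. ncps_nth (ncps_monom []) (take i u @ drop j u) *
            ncps_nth g (drop i (take j u))) = (if i = 0 then ncps_nth g u else 0)"
        by auto
    qed
    then show ?case using G1 by (auto simp: E_def)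
  next
    case (Cons x w)
    have *: "ncps_nth (g * ncps_monom (x # w)) u =
        (\<Sum>j\<in>{0..length u}. ncps_nth (ncps_monom (x # w)) (drop j u) * ncps_nth g (take j u))"
      by (simp add: ncps_nth_mult mult.commute atLeast0AtMost)
    show ?case
    proof (cases u)
      case Nil
      then show ?thesis by (simp add: E_Cons ncps_nth_mult[of g] insertion_def)
    next
      case (Cons y v)
      \<comment> \<open>The terms with \<open>i = 0\<close> form the product; in all others the
        first letter \<open>y\<close> survives and must equal \<open>x\<close>.\<close>
      have "insertion (ncps_nth (ncps_monom (x # w))) (ncps_nth g) u =
          ncps_nth (g * ncps_monom (x # w)) u +
          (\<Sum>i\<le>length v. \<Sum>j\<in>{i..length v}.
            ncps_nth (ncps_monom (x # w)) (y # take i v @ drop j v) * ncps_nth g (drop i (take j v)))"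
        unfolding insertion_def *
        by (simp add: Cons sum.atMost_Suc_shift sum.shift_bounds_cl_Suc_ivl
            del: sum.atMost_Suc sum.cl_ivl_Suc)
      also have "(\<Sum>i\<le>length v. \<Sum>j\<in>{i..length v}.
            ncps_nth (ncps_monom (x # w)) (y # take i v @ drop j v) * ncps_nth g (drop i (take j v)))
          = (if y = x then insertion (ncps_nth (ncps_monom w)) (ncps_nth g) v else 0)"
        by (simp add: insertion_def ncps_nth_monom)
      finally show ?thesis
        using Cons.IH by (simp add: E_Cons \<open>u = y # v\<close>)
    qed
  qed
  then show ?thesis by (simp only: E_def)
qed

lemma nth_pre_lie_prod: "ncps_nth (pre_lie_prod f g) u = insertion (ncps_nth f) (ncps_nth g) u"
proof -
  define W where "W = {w. set w \<subseteq> set u \<and> length w \<le> length u}"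
  define F where "F = 1 + ncps_smult [:[:0, 1:]:] (ncps_map (\<lambda>a. [:[:a:]:]) f)"
  define G where "G = 1 + ncps_smult [:0, 1:] (ncps_map (\<lambda>a. [:[:a:]:]) g)"
  let ?P = "\<lambda>w. prod_list (map (\<lambda>i. ncps_X i * G) w)"
  have fin: "finite W"
    unfolding W_def by (rule finite_lists_length_le) simp
  have G0: "degree0_part G = 1" and G1: "degree1_part G = g"
    by (rule ncps_eqI; simp add: G_def)+
  have "poly.coeff (poly.coeff (ncps_nth F w * ncps_nth (G * ?P w) u) 1) 1 =
      ncps_nth f w * ncps_nth (degree1_part (G * ?P w)) u" for w
  proof -
    \<comment> \<open>The constant term of \<open>F\<close> contains a \<open>1\<close> without
      \<open>s\<close>; it contributes nothing, since \<open>G\<close> is free of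
      \<open>s\<close>.\<close>
    have "poly.coeff (poly.coeff (ncps_nth (G * ?P []) u) 1) 1 = 0"
      by (simp add: G_def)
    then show ?thesis
      by (cases "w = []") (simp_all add: F_def distrib_right)
  qed
  then have "ncps_nth (pre_lie_prod f g) u =
      (\<Sum>w\<in>W. ncps_nth f w * ncps_nth (degree1_part (G * ?P w)) u)"
    unfolding pre_lie_prod_def bidegree_component_def Let_def F_def[symmetric] G_def[symmetric]
      ncps_nth_simps(5)
    by (subst nth_shifted_comp[OF fin]) (auto simp: W_def coeff_sum)
  also have "\<dots> = (\<Sum>w\<in>W. ncps_nth f w * insertion (ncps_nth (ncps_monom w)) (ncps_nth g) u)"
    by (simp only: insertion_into_monom[OF G0 G1])
  \<comment> \<open>With the sum over \<open>w\<close> innermost, \<open>ncps_monom w\<close>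
    selects the single word \<open>take i u @ drop j u\<close>.\<close>
  also have "\<dots> = (\<Sum>i\<le>length u. \<Sum>j\<in>{i..length u}. \<Sum>w\<in>W.
      ncps_nth f w *
        (ncps_nth (ncps_monom w) (take i u @ drop j u) * ncps_nth g (drop i (take j u))))"
    unfolding insertion_def sum_distrib_left
    by (subst sum.swap, intro sum.cong refl, rule sum.swap)
  also have "\<dots> = insertion (ncps_nth f) (ncps_nth g) u"
    unfolding insertion_def
  proof (intro sum.cong refl)
    fix i j assume ij: "j \<in> {i..length u}"
    let ?v = "take i u @ drop j u"
    have "?v \<in> W"
      using ij by (auto simp: W_def dest: in_set_takeD in_set_dropD)
    have "(\<Sum>w\<in>W. ncps_nth f w * (ncps_nth (ncps_monom w) ?v * ncps_nth g (drop i (take j u)))) =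
        (\<Sum>w\<in>W. if w = ?v then ncps_nth f ?v * ncps_nth g (drop i (take j u)) else 0)"
      by (intro sum.cong) (auto simp: ncps_nth_monom)
    with \<open>?v \<in> W\<close> fin show "(\<Sum>w\<in>W. ncps_nth f w *
        (ncps_nth (ncps_monom w) ?v * ncps_nth g (drop i (take j u)))) =
        ncps_nth f ?v * ncps_nth g (drop i (take j u))"
      by simp
  qed
  finally show ?thesis .
qed

section \<open>The pre-Lie algebra over \<open>A\<close> and, by restriction of scalars, over the
  base field\<close>

lemma right_pre_lie_algebra_smult:
  "right_pre_lie_algebra (ncps_smult :: 'a::comm_ring_1 \<Rightarrow> 'a ncps \<Rightarrow> 'a ncps) G0 pre_lie_prod"
proof -
  interpret module "ncps_smult :: 'a \<Rightarrow> 'a ncps \<Rightarrow> 'a ncps"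
    by standard (auto intro!: ncps_eqI simp: algebra_simps)
  show ?thesis
  proof
    show "subspace (G0 :: 'a ncps set)"
      by (auto simp: subspace_def G0_def)
  next
    fix a b c :: "'a ncps"
    have nth: "ncps_nth (pre_lie_prod f g) = insertion (ncps_nth f) (ncps_nth g)" for f g :: "'a ncps"
      by (rule ext) (rule nth_pre_lie_prod)
    show "pre_lie_prod (pre_lie_prod a b) c - pre_lie_prod a (pre_lie_prod b c) =
        pre_lie_prod (pre_lie_prod a c) b - pre_lie_prod a (pre_lie_prod c b)"
      by (rule ncps_eqI) (simp add: nth insertion_right_pre_lie)
  \<comment> \<open>Closure of \<open>G0\<close>: at the empty word the insertion sum is the single
    term \<open>f [] * g []\<close>.\<close>
  qed (auto simp: G0_def nth_pre_lie_prod insertion_def algebra_simps sum.distrib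
      sum_distrib_left intro!: ncps_eqI)
qed

text \<open>The field acts through its image in \<open>A\<close>, so each axiom over it is an
  instance of the one over \<open>A\<close>.\<close>

lemma (in comm_unital_algebra) ncps_map_scale: "ncps_map (scale c) f = ncps_smult (scale c 1) f"
  by (rule ncps_eqI) (simp add: scale_mult_left[symmetric])

theorem proposition3p2:
  fixes scaleK :: "'k::field_char_0 \<Rightarrow> 'a::comm_ring_1 \<Rightarrow> 'a"
  assumes "comm_unital_algebra scaleK"
  shows "right_pre_lie_algebra (ncps_smult :: 'a \<Rightarrow> 'a ncps \<Rightarrow> 'a ncps) G0 pre_lie_prod
    \<and> right_pre_lie_algebra (\<lambda>c :: 'k. ncps_map (scaleK c)) G0 pre_lie_prod"
proof
  interpret K: comm_unital_algebra scaleK by fact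
  interpret A: right_pre_lie_algebra "ncps_smult :: 'a \<Rightarrow> 'a ncps \<Rightarrow> 'a ncps" G0 pre_lie_prod
    by (rule right_pre_lie_algebra_smult)
  show "right_pre_lie_algebra (ncps_smult :: 'a \<Rightarrow> 'a ncps \<Rightarrow> 'a ncps) G0 pre_lie_prod"
    by (rule right_pre_lie_algebra_smult)
  interpret M: module "\<lambda>c :: 'k. ncps_map (scaleK c)"
    by standard (auto intro!: ncps_eqI simp: K.scale_right_distrib K.scale_left_distrib)
  show "right_pre_lie_algebra (\<lambda>c :: 'k. ncps_map (scaleK c)) G0 pre_lie_prod"
  proof
    show "M.subspace G0"
      using A.subspace_carrier
      by (simp add: M.subspace_def A.subspace_def K.ncps_map_scale)
  qed (simp_all add: K.ncps_map_scale A.prod_closed A.prod_add_left A.prod_add_right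
      A.prod_scale_left A.prod_scale_right A.right_pre_lie)
qed

end
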